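(* Let $m\ge 1$ be an integer, $l>0$, $T>0$, let $0=t_0<\cdots<t_I=T$ and $-l=x_0<\cdots<x_J=l$, and let $A_n^{(i,j)}\in\mathbb{R}$ for $0\le n\le 2m$, $0\le i\le I-1$, $0\le j\le J-1$. Put $$A_n(t,x)=\sum_{i=0}^{I-1}\sum_{j=0}^{J-1}A_n^{(i,j)}\,\chi_{[t_i,t_{i+1}[\times[x_j,x_{j+1}[}(t,x).$$ Consider the initial value problem consisting of the equation $$\frac{\partial}{\partial t}\Psi(t,x)=\sum_{n=0}^{2m}A_n(t,x)\frac{\partial^n}{\partial x^n}\Psi(t,x),\qquad (t,x)\in[0,T[\times[-l,l[,$$ and the initial condition $$\Psi(0,x)=\frac{c_0}{2}+\sum_{k=1}^\infty\Big(c_k\cos\Big(\frac{k\pi x}{l}\Big)+d_k\sin\Big(\frac{k\pi x}{l}\Big)\Big)\in FD^{(0)}[-l,l[,$$ where $c_0,c_1,d_1,c_2,d_2,\dots$ are real numbers. Let the numbers $\sigma_k^{(i,j)},\omega_k^{(i,j)}$, the coefficients $c_0^{(i,j)},c_k^{(i,j)},d_k^{(i,j)}$ and the series $\Psi_{(i,j)}(t,x)$ be defined from these data as in the context. Suppose that for all $0\le i\le I-1$ and $0\le j\le J-1$ the series $\Psi_{(i,j)}(t,x)$ belongs to the class $FD^{(2m)}[-l,l[$ as a series of the variable $x$ for all $t\ge 0$, and is differentiable term by term as a series of the variable $t$ for all $x\in[-l,l[$. Then the function $\Psi:[0,T[\times[-l,l[\to\mathbb{R}$ defined by $$\Psi(t,x)=\sum_{i=0}^{I-1}\sum_{j=0}^{J-1}\Psi_{(i,j)}(t,x)\,\chi_{[t_i,t_{i+1}[\times[x_j,x_{j+1}[}(t,x)$$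 is a weak solution of this initial value problem.
   Context: Notation. $[a,b[$ denotes the half-open interval $\{s: a\le s<b\}$ and $\chi_S$ the indicator function of the set $S$. Class $FD^{(n)}[-l,l[$. For $n\in\mathbb{N}$, $FD^{(n)}[-l,l[$ is the vector space of all $n$-times differentiable real functions $f$ on $[-l,l[$ such that for every $0\le k\le n-1$ the series obtained by term-by-term differentiation of the Fourier series of $f^{(k)}$ (in the system $1,\cos(k\pi x/l),\sin(k\pi x/l)$) converges pointwise to $f^{(k+1)}(x)$ for all $x\in[-l,l[$. (Derivatives at the endpoint $-l$ are one-sided.) $FD^{(0)}[-l,l[$ is the space of functions on $[-l,l[$ that are the pointwise sum of their Fourier series. Saying that a trigonometric series belongs to $FD^{(n)}[-l,l[$ as a series of the variable $x$ means that it converges at every $x\in[-l,l[$, that it is the Fourier series of its sum, and that its sum belongs to $FD^{(n)}[-l,l[$. A series of functions of $t$ is differentiable term by term if its sum is differentiable in $t$ (for $t\ge0$, one-sidedly at $0$) and the derivative of the sum equals the sum of the series of derivatives. Frequencies. For $k\ge1$, $0\le i\le I-1$, $0\le j\le J-1$, $$\sigma_k^{(i,j)}=\sum_{n=0}^{m}(-1)^nA_{2n}^{(i,j)}\Big(\frac{k\pi}{l}\Big)^{2n},\qquad \omega_k^{(i,j)}=\sum_{n=0}^{m-1}(-1)^nA_{2n+1}^{(i,j)}\Big(\frac{k\pi}{l}\Big)^{2n+1}.$$ Coefficients. For every $0\le j\le J-1$ put $c_0^{(0,j)}=c_0$, $c_k^{(0,j)}=c_k$, $d_k^{(0,j)}=d_k$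 ($k\ge1$). For $1\le s\le I-1$ define recursively $$c_0^{(s,j)}=e^{t_s(A_0^{(s-1,j)}-A_0^{(s,j)})}c_0^{(s-1,j)},$$ and, for $k\ge1$, $$c_k^{(s,j)}=\mathbb{A}\cos(\omega_k^{(s,j)}t_s)-\mathbb{B}\sin(\omega_k^{(s,j)}t_s),\qquad d_k^{(s,j)}=\mathbb{B}\cos(\omega_k^{(s,j)}t_s)+\mathbb{A}\sin(\omega_k^{(s,j)}t_s),$$ where (depending on $k,s,j$) $$\mathbb{A}=e^{(\sigma_k^{(s-1,j)}-\sigma_k^{(s,j)})t_s}\big(c_k^{(s-1,j)}\cos(\omega_k^{(s-1,j)}t_s)+d_k^{(s-1,j)}\sin(\omega_k^{(s-1,j)}t_s)\big),$$ $$\mathbb{B}=e^{(\sigma_k^{(s-1,j)}-\sigma_k^{(s,j)})t_s}\big(d_k^{(s-1,j)}\cos(\omega_k^{(s-1,j)}t_s)-c_k^{(s-1,j)}\sin(\omega_k^{(s-1,j)}t_s)\big).$$ Series. For $0\le i\le I-1$, $0\le j\le J-1$, $$\Psi_{(i,j)}(t,x)=\frac{e^{tA_0^{(i,j)}}c_0^{(i,j)}}{2}+\sum_{k=1}^\infty e^{\sigma_k^{(i,j)}t}\Big(\big(c_k^{(i,j)}\cos(\omega_k^{(i,j)}t)+d_k^{(i,j)}\sin(\omega_k^{(i,j)}t)\big)\cos\Big(\frac{k\pi x}{l}\Big)+\big(d_k^{(i,j)}\cos(\omega_k^{(i,j)}t)-c_k^{(i,j)}\sin(\omega_k^{(i,j)}t)\big)\sin\Big(\frac{k\pi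 x}{l}\Big)\Big).$$ Weak solution. A function $\Psi:[0,T[\times[-l,l[\to\mathbb{R}$ is a weak solution of the initial value problem if: (i) $\Psi$ satisfies the differential equation at each $(t,x)\in[0,T[\times[-l,l[$ with $t\ne t_i$ for all $0\le i\le I$ and $x\ne x_j$ for all $0\le j\le J$; (ii) $\Psi$ satisfies the initial condition; (iii) for each fixed $x\in[-l,l[$ the function $\Psi(t,x)$ is continuous with respect to $t\in[0,T[$, and for each $t\in[0,T[$ the function $\Psi(t,x)$ is continuous with respect to $x$ on $[-l,l[$ except at the points $\{x_j:0\le j\le J-1\}$. *)

theory Defs
  imports "HOL-Analysis.Analysis"
begin

section \<open>Trigonometric series and the classes FD\<close>

text \<open>Functions on the half-open interval from \<open>-l\<close> to \<open>l\<close> are represented by total functions of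
  which only the values on \<open>{-l..<l}\<close> matter.\<close>

definition trig_term :: "real \<Rightarrow> (nat \<Rightarrow> real) \<Rightarrow> (nat \<Rightarrow> real) \<Rightarrow> nat \<Rightarrow> real \<Rightarrow> real" where
  "trig_term l a b k x =
     (if k = 0 then a 0 / 2
      else a k * cos (real k * pi * x / l) + b k * sin (real k * pi * x / l))"

text \<open>Meaningful for functions that are Lebesgue integrable (\<open>absolutely_integrable_on\<close>), for which
  the gauge integral below is the Lebesgue integral.\<close>

definition fourier_cos :: "real \<Rightarrow> (real \<Rightarrow> real) \<Rightarrow> nat \<Rightarrow> real" where
  "fourier_cos l f k = (1 / l) * integral {-l..<l} (\<lambda>x. f x * cos (real k * pi * x / l))"

definition fourier_sin :: "real \<Rightarrow> (real \<Rightarrow> real) \<Rightarrow> nat \<Rightarrow> real" where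
  "fourier_sin l f k = (1 / l) * integral {-l..<l} (\<lambda>x. f x * sin (real k * pi * x / l))"

text \<open>In the case \<open>n > 0\<close>, \<open>D k\<close> is the \<open>k\<close>-th derivative of \<open>f\<close>, one-sided at \<open>-l\<close>; it is uniquely
  determined on \<open>{-l..<l}\<close>.\<close>

definition FD :: "real \<Rightarrow> nat \<Rightarrow> (real \<Rightarrow> real) set" where
  "FD l n = {f.
     if n = 0 then
       f absolutely_integrable_on {-l..<l} \<and>
       (\<forall>x\<in>{-l..<l}. (\<lambda>j. trig_term l (fourier_cos l f) (fourier_sin l f) j x) sums f x)
     else
       (\<exists>D :: nat \<Rightarrow> real \<Rightarrow> real.
          (\<forall>x\<in>{-l..<l}. D 0 x = f x) \<and>
          (\<forall>k<n. \<forall>x\<in>{-l..<l}. (D k has_real_derivative D (Suc k) x) (at x within {-l..<l})) \<and>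
          (\<forall>k<n. D k absolutely_integrable_on {-l..<l} \<and>
             (\<forall>x\<in>{-l..<l}.
                (\<lambda>j. deriv (trig_term l (fourier_cos l (D k)) (fourier_sin l (D k)) j) x)
                  sums D (Suc k) x)))}"

text \<open>The trigonometric series with coefficients \<open>a\<close>, \<open>b\<close> belongs to the class \<open>FD l n\<close>
  (the value \<open>b 0\<close> is not part of the series).\<close>

definition trig_series_in_FD :: "real \<Rightarrow> nat \<Rightarrow> (nat \<Rightarrow> real) \<Rightarrow> (nat \<Rightarrow> real) \<Rightarrow> bool" where
  "trig_series_in_FD l n a b \<longleftrightarrow>
     (\<forall>x\<in>{-l..<l}. summable (\<lambda>k. trig_term l a b k x)) \<and>
     (let F = (\<lambda>x. \<Sum>k. trig_term l a b k x) in
        F absolutely_integrable_on {-l..<l} \<and>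
        (\<forall>k. a k = fourier_cos l F k) \<and>
        (\<forall>k\<ge>1. b k = fourier_sin l F k) \<and>
        F \<in> FD l n)"

definition termwise_differentiable :: "(nat \<Rightarrow> real \<Rightarrow> real) \<Rightarrow> bool" where
  "termwise_differentiable u \<longleftrightarrow>
     (\<forall>t\<ge>0. summable (\<lambda>k. u k t)) \<and>
     (\<forall>t\<ge>0. \<exists>u' S. (\<forall>k. (u k has_real_derivative u' k) (at t within {0..})) \<and>
        u' sums S \<and>
        ((\<lambda>s. \<Sum>k. u k s) has_real_derivative S) (at t within {0..}))"


section \<open>The candidate solution\<close>

definition cos_amp :: "real \<Rightarrow> real \<Rightarrow> real \<Rightarrow> real \<Rightarrow> real \<Rightarrow> real" where
  "cos_amp \<sigma> \<omega> c d t = exp (\<sigma> * t) * (c * cos (\<omega> * t) + d * sin (\<omega> * t))"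

definition sin_amp :: "real \<Rightarrow> real \<Rightarrow> real \<Rightarrow> real \<Rightarrow> real \<Rightarrow> real" where
  "sin_amp \<sigma> \<omega> c d t = exp (\<sigma> * t) * (d * cos (\<omega> * t) - c * sin (\<omega> * t))"

text \<open>Encoding of the data: \<open>A n i j\<close> is \<open>A_n^{(i,j)}\<close>, \<open>\<tau> i\<close> is \<open>t_i\<close>, \<open>\<xi> j\<close> is \<open>x_j\<close>;
  \<open>coeff_c i j k\<close> and \<open>coeff_d i j k\<close> are \<open>c_k^{(i,j)}\<close> and \<open>d_k^{(i,j)}\<close>, where \<open>d 0\<close> and
  \<open>coeff_d i j 0\<close> are never used.\<close>

context
  fixes m :: nat and l :: real and A :: "nat \<Rightarrow> nat \<Rightarrow> nat \<Rightarrow> real"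
begin

definition freq_sigma :: "nat \<Rightarrow> nat \<Rightarrow> nat \<Rightarrow> real" where
  "freq_sigma i j k = (\<Sum>n=0..m. (-1) ^ n * A (2 * n) i j * (real k * pi / l) ^ (2 * n))"

definition freq_omega :: "nat \<Rightarrow> nat \<Rightarrow> nat \<Rightarrow> real" where
  "freq_omega i j k =
     (\<Sum>n<m. (-1) ^ n * A (2 * n + 1) i j * (real k * pi / l) ^ (2 * n + 1))"

context
  fixes \<tau> :: "nat \<Rightarrow> real" and c d :: "nat \<Rightarrow> real"
begin

fun coeff_c coeff_d :: "nat \<Rightarrow> nat \<Rightarrow> nat \<Rightarrow> real" where
  "coeff_c 0 j k = c k"
| "coeff_d 0 j k = d k"
| "coeff_c (Suc s) j k =
     (if k = 0 then exp (\<tau> (Suc s) * (A 0 s j - A 0 (Suc s) j)) * coeff_c s j 0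
      else
        let t = \<tau> (Suc s);
            \<sigma> = freq_sigma s j k - freq_sigma (Suc s) j k;
            P = cos_amp \<sigma> (freq_omega s j k) (coeff_c s j k) (coeff_d s j k) t;
            Q = sin_amp \<sigma> (freq_omega s j k) (coeff_c s j k) (coeff_d s j k) t
        in P * cos (freq_omega (Suc s) j k * t) - Q * sin (freq_omega (Suc s) j k * t))"
| "coeff_d (Suc s) j k =
     (let t = \<tau> (Suc s);
          \<sigma> = freq_sigma s j k - freq_sigma (Suc s) j k;
          P = cos_amp \<sigma> (freq_omega s j k) (coeff_c s j k) (coeff_d s j k) t;
          Q = sin_amp \<sigma> (freq_omega s j k) (coeff_c s j k) (coeff_d s j k) t
      in Q * cos (freq_omega (Suc s) j k * t) + P * sin (freq_omega (Suc s) j k * t))"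

text \<open>The series \<open>\<Psi>_{(i,j)}(t,x)\<close>, for fixed \<open>t\<close>, as a trigonometric series in \<open>x\<close>.\<close>

definition psi_cos :: "nat \<Rightarrow> nat \<Rightarrow> real \<Rightarrow> nat \<Rightarrow> real" where
  "psi_cos i j t k =
     (if k = 0 then exp (t * A 0 i j) * coeff_c i j 0
      else cos_amp (freq_sigma i j k) (freq_omega i j k) (coeff_c i j k) (coeff_d i j k) t)"

definition psi_sin :: "nat \<Rightarrow> nat \<Rightarrow> real \<Rightarrow> nat \<Rightarrow> real" where
  "psi_sin i j t k =
     sin_amp (freq_sigma i j k) (freq_omega i j k) (coeff_c i j k) (coeff_d i j k) t"

definition psi_term :: "nat \<Rightarrow> nat \<Rightarrow> nat \<Rightarrow> real \<Rightarrow> real \<Rightarrow> real" where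
  "psi_term i j k t x = trig_term l (psi_cos i j t) (psi_sin i j t) k x"

definition psi_piece :: "nat \<Rightarrow> nat \<Rightarrow> real \<Rightarrow> real \<Rightarrow> real" where
  "psi_piece i j t x = (\<Sum>k. psi_term i j k t x)"

end

end


section \<open>Piecewise data and weak solutions\<close>

definition piecewise ::
  "nat \<Rightarrow> nat \<Rightarrow> (nat \<Rightarrow> real) \<Rightarrow> (nat \<Rightarrow> real) \<Rightarrow>
   (nat \<Rightarrow> nat \<Rightarrow> real \<Rightarrow> real \<Rightarrow> real) \<Rightarrow> real \<Rightarrow> real \<Rightarrow> real" where
  "piecewise I J \<tau> \<xi> g t x =
     (\<Sum>i<I. \<Sum>j<J. g i j t x * indicator ({\<tau> i..<\<tau> (Suc i)} \<times> {\<xi> j..<\<xi> (Suc j)}) (t, x))"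

text \<open>Existence of the \<open>n\<close>-th derivative at \<open>x\<close>: the derivatives of order below \<open>n\<close> exist near \<open>x\<close>,
  and the last of them is differentiable at \<open>x\<close>. The value is then \<open>(deriv ^^ n) f x\<close>.\<close>

definition times_differentiable_at :: "nat \<Rightarrow> (real \<Rightarrow> real) \<Rightarrow> real \<Rightarrow> bool" where
  "times_differentiable_at n f x \<longleftrightarrow>
     (\<forall>k<n. ((deriv ^^ k) f) differentiable (at x)) \<and>
     (\<forall>k. Suc k < n \<longrightarrow> (\<forall>\<^sub>F y in nhds x. ((deriv ^^ k) f) differentiable (at y)))"

text \<open>The equation is only required at points off the grid \<open>t = \<tau> i\<close>, \<open>x = \<xi> j\<close>; when \<open>\<tau> 0 = 0\<close> and
  \<open>\<xi> 0 = -l\<close> these are interior points of the domain, so the two-sided derivatives do not depend on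
  values outside of it.\<close>

definition weak_solution ::
  "nat \<Rightarrow> real \<Rightarrow> real \<Rightarrow> nat \<Rightarrow> nat \<Rightarrow> (nat \<Rightarrow> real) \<Rightarrow> (nat \<Rightarrow> real) \<Rightarrow>
   (nat \<Rightarrow> real \<Rightarrow> real \<Rightarrow> real) \<Rightarrow> (nat \<Rightarrow> real) \<Rightarrow> (nat \<Rightarrow> real) \<Rightarrow>
   (real \<Rightarrow> real \<Rightarrow> real) \<Rightarrow> bool" where
  "weak_solution m l T I J \<tau> \<xi> a c d \<Psi> \<longleftrightarrow>
     (\<forall>t\<in>{0..<T}. \<forall>x\<in>{-l..<l}. (\<forall>i\<le>I. t \<noteq> \<tau> i) \<longrightarrow> (\<forall>j\<le>J. x \<noteq> \<xi> j) \<longrightarrow>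
        (\<lambda>s. \<Psi> s x) differentiable (at t) \<and>
        times_differentiable_at (2 * m) (\<Psi> t) x \<and>
        deriv (\<lambda>s. \<Psi> s x) t = (\<Sum>n=0..2 * m. a n t x * (deriv ^^ n) (\<Psi> t) x)) \<and>
     (\<forall>x\<in>{-l..<l}. (\<lambda>k. trig_term l c d k x) sums \<Psi> 0 x) \<and>
     (\<forall>x\<in>{-l..<l}. continuous_on {0..<T} (\<lambda>t. \<Psi> t x)) \<and>
     (\<forall>t\<in>{0..<T}. \<forall>x\<in>{-l..<l} - \<xi> ` {..<J}. continuous (at x within {-l..<l}) (\<Psi> t))"

end

theory Submission
  imports Defs
begin

text \<open>Inside a cell of the grid the coefficients are constant, and a single term
  \<open>cos_amp \<sigma> \<omega> p q t * cos (\<kappa> * x) + sin_amp \<sigma> \<omega> p q t * sin (\<kappa> * x)\<close> with \<open>\<kappa> = k * pi / l\<close>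
  solves the equation exactly: an even number \<open>2 * n\<close> of \<open>x\<close>-derivatives multiplies it by
  \<open>(-1) ^ n * \<kappa> ^ (2 * n)\<close>, so the even-order part of the operator acts as \<open>\<sigma>\<close>; the odd-order part acts
  as \<open>\<omega>\<close> times the conjugate term; and this is the \<open>t\<close>-derivative
  (\<open>spatial_operator_trig_term\<close>, \<open>psi_term_satisfies_equation\<close>). It remains to differentiate the
  whole series. In \<open>t\<close> this is the hypothesis of termwise differentiability. In \<open>x\<close> there is a gap:
  membership in \<open>FD\<close> says that \<open>D (n+1)\<close> is the sum of the termwise differentiated Fourier series of
  \<open>D n\<close>, with \<open>D n\<close> the \<open>n\<close>-th derivative of the sum, but not that the latter series is itself the
  \<open>n\<close> times differentiated original one. For this the termwise derivative of the Fourier series of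
  \<open>D n\<close> has to be the Fourier series of \<open>D (n+1)\<close>.

  That is \<open>fourier_series_of_derivative\<close>. Integration by parts gives the expected coefficients up to
  a boundary term \<open>(-1) ^ k * J\<close> in the cosine coefficients, \<open>J\<close> being the normalized jump of \<open>D n\<close>
  between the two ends of the period. The convergence built into \<open>FD\<close> rules the jump out: at \<open>x = -l\<close> the differentiated series of \<open>D n\<close>
  forces \<open>\<kappa> * b k\<close> to tend to \<open>0\<close>, and at \<open>x = -l/2\<close>
  the differentiated series of \<open>D (n+1)\<close> forces its cosine coefficients of odd index to tend to \<open>0\<close>,
  so the constant \<open>J\<close> is a limit of a sequence tending to \<open>0\<close>. Iterating,
  all derivatives up to order \<open>2 * m\<close> may be taken term by term (\<open>trig_series_in_FD_derivatives\<close>).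

  Continuity in time across \<open>t = \<tau> (i+1)\<close> holds because the recursion for the coefficients rotates
  backwards by the new frequency what the old one had produced at that time, so that consecutive
  series agree there term by term (\<open>psi_piece_match\<close>). The remaining claims are local on the cells,
  where the sum over all cells reduces to the series of one of them (\<open>piecewise_on_cell\<close>).\<close>

section \<open>Derivatives of trigonometric terms\<close>

lemma trig_term_has_real_derivative:
  "(trig_term l a b k has_real_derivative
     trig_term l (\<lambda>k. real k * pi / l * b k) (\<lambda>k. - (real k * pi / l * a k)) k x) (at x)"
proof (cases "k = 0")
  case True
  have "trig_term l a b 0 = (\<lambda>x. a 0 / 2)" by (simp add: trig_term_def fun_eq_iff)
  with True show ?thesis by (simp add: trig_term_def)
next
  case False
  have arg: "real k * pi * y / l = real k * pi / l * y" for y by simp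
  have eq: "trig_term l a b k = (\<lambda>x. a k * cos (real k * pi / l * x) + b k * sin (real k * pi / l * x))"
    using False unfolding trig_term_def arg fun_eq_iff by simp
  have "((\<lambda>x. p * cos (\<kappa> * x) + q * sin (\<kappa> * x)) has_real_derivative
      \<kappa> * q * cos (\<kappa> * x) + - (\<kappa> * p) * sin (\<kappa> * x)) (at x)" for \<kappa> p q :: real
    by (auto intro!: derivative_eq_intros)
  from this[of "a k" "real k * pi / l" "b k"] show ?thesis
    by (simp only: eq) (simp only: trig_term_def arg False if_False)
qed

text \<open>The derivative is again a trigonometric term, so differentiation of a series becomes an
  operation on its coefficients that can be iterated.\<close>

lemma deriv_trig_term:
  "deriv (trig_term l a b k) =
     trig_term l (\<lambda>k. real k * pi / l * b k) (\<lambda>k. - (real k * pi / l * a k)) k"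
  using DERIV_imp_deriv[OF trig_term_has_real_derivative] by (simp add: fun_eq_iff)

lemma funpow_deriv_trig_term_even:
  "(deriv ^^ (2 * n)) (trig_term l a b k) x = (-1) ^ n * (real k * pi / l) ^ (2 * n) * trig_term l a b k x"
proof (induction n arbitrary: a b)
  case (Suc n)
  define a'' where "a'' = (\<lambda>k. - ((real k * pi / l)\<^sup>2 * a k))"
  define b'' where "b'' = (\<lambda>k. - ((real k * pi / l)\<^sup>2 * b k))"
  have "deriv (deriv (trig_term l a b k)) = trig_term l a'' b'' k"
    by (simp add: deriv_trig_term a''_def b''_def power2_eq_square mult.assoc)
  then have "(deriv ^^ (2 * Suc n)) (trig_term l a b k) x
      = (deriv ^^ (2 * n)) (trig_term l a'' b'' k) x"
    by (simp add: funpow_Suc_right del: funpow.simps)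
  also have "\<dots> = (-1) ^ n * (real k * pi / l) ^ (2 * n) * trig_term l a'' b'' k x"
    by (rule Suc.IH)
  also have "trig_term l a'' b'' k x = - (real k * pi / l)\<^sup>2 * trig_term l a b k x"
    by (simp add: trig_term_def a''_def b''_def algebra_simps)
  finally show ?case by (simp add: power_add power2_eq_square algebra_simps)
qed simp

lemma funpow_deriv_trig_term_odd:
  "(deriv ^^ (2 * n + 1)) (trig_term l a b k) x =
     (-1) ^ n * (real k * pi / l) ^ (2 * n + 1)
       * (b k * cos (real k * pi * x / l) - a k * sin (real k * pi * x / l))"
proof -
  have "(deriv ^^ (2 * n + 1)) (trig_term l a b k) x
      = (deriv ^^ (2 * n)) (deriv (trig_term l a b k)) x"
    by (simp add: funpow_Suc_right del: funpow.simps)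
  also have "\<dots> = (-1) ^ n * (real k * pi / l) ^ (2 * n) * deriv (trig_term l a b k) x"
    unfolding deriv_trig_term by (rule funpow_deriv_trig_term_even)
  also have "deriv (trig_term l a b k) x
      = (real k * pi / l) * (b k * cos (real k * pi * x / l) - a k * sin (real k * pi * x / l))"
    by (simp add: deriv_trig_term trig_term_def algebra_simps)
  finally show ?thesis by (simp add: algebra_simps)
qed

section \<open>The Fourier series of a derivative\<close>

text \<open>Integration by parts against \<open>cos\<close> and \<open>sin\<close>. The boundary term vanishes for \<open>sin\<close>; for
  \<open>cos\<close> it is \<open>(-1) ^ k * J\<close>, where \<open>l * J\<close> is the left limit of \<open>g\<close> at \<open>l\<close> minus \<open>g (-l)\<close>.\<close>

lemma fourier_coeffs_of_derivative:
  fixes g h :: "real \<Rightarrow> real"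
  assumes l: "l > 0"
    and g: "\<And>x. x \<in> {-l..<l} \<Longrightarrow> (g has_real_derivative h x) (at x within {-l..<l})"
    and h: "h integrable_on {-l..<l}"
  obtains J where
    "\<And>k. fourier_cos l h k = (-1) ^ k * J + real k * pi / l * fourier_sin l g k"
    "\<And>k. fourier_sin l h k = - (real k * pi / l * fourier_cos l g k)"
proof -
  \<comment> \<open>The indefinite integral of \<open>h\<close> extends \<open>g\<close> continuously to the right end point.\<close>
  define G where "G = (\<lambda>x. g (-l) + integral {-l..x} h)"
  have ae: "negligible (sym_diff {-l..<l} {-l..l})"
    by (rule negligible_subset[of "{l}"]) auto
  have h': "h integrable_on {-l..l}"
    using h integrable_spike_set_eq[OF ae] by blast
  have Gg: "G x = g x" if x: "x \<in> {-l..<l}" for x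
  proof -
    have "(h has_integral g x - g (-l)) {-l..x}"
      using x by (intro fundamental_theorem_of_calculus)
        (auto simp flip: has_real_derivative_iff_has_vector_derivative intro!: DERIV_subset[OF g])
    then show ?thesis by (simp add: G_def integral_unique)
  qed
  have Gc: "continuous_on {-l..l} G"
    unfolding G_def by (intro continuous_intros indefinite_integral_continuous_1 h')
  have dG: "(G has_real_derivative h x) (at x)" if x: "x \<in> {-l<..<l}" for x
  proof -
    have "at x within {-l..<l} = at x"
      by (rule at_within_open_subset[of _ "{-l<..<l}"]) (use x in auto)
    then have "(g has_real_derivative h x) (at x)"
      using g[of x] x by simp
    then show ?thesis
      by (rule has_field_derivative_transform_within_open[of _ _ _ "{-l<..<l}"]) (use x Gg in auto)
  qed
  have parts: "integral {-l..<l} (\<lambda>x. h x * p x)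
      = G l * p l - G (-l) * p (-l) - integral {-l..<l} (\<lambda>x. g x * p' x)"
    if p: "\<And>x. (p has_real_derivative p' x) (at x)" and p': "continuous_on UNIV p'" for p p'
  proof -
    have pc: "continuous_on UNIV p"
      using p by (auto intro!: DERIV_continuous_on)
    have 1: "((\<lambda>x. G x * p' x + h x * p x) has_integral G l * p l - G (-l) * p (-l)) {-l..l}"
    proof (rule fundamental_theorem_of_calculus_interior)
      show "continuous_on {-l..l} (\<lambda>x. G x * p x)"
        by (intro continuous_intros Gc continuous_on_subset[OF pc]) auto
      show "((\<lambda>x. G x * p x) has_vector_derivative G x * p' x + h x * p x) (at x)"
        if "x \<in> {-l<..<l}" for x
        unfolding has_real_derivative_iff_has_vector_derivative[symmetric]
        using DERIV_mult'[OF dG[OF that] p] by simp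
    qed (use l in auto)
    have 2: "(\<lambda>x. G x * p' x) integrable_on {-l..l}"
      by (intro integrable_continuous_interval continuous_intros Gc continuous_on_subset[OF p']) auto
    have "((\<lambda>x. h x * p x) has_integral
        G l * p l - G (-l) * p (-l) - integral {-l..l} (\<lambda>x. G x * p' x)) {-l..l}"
      using has_integral_diff[OF 1 integrable_integral[OF 2]] by simp
    then have "integral {-l..l} (\<lambda>x. h x * p x)
        = G l * p l - G (-l) * p (-l) - integral {-l..l} (\<lambda>x. G x * p' x)"
      by (rule integral_unique)
    moreover have "integral {-l..<l} (\<lambda>x. h x * p x) = integral {-l..l} (\<lambda>x. h x * p x)"
      by (intro integral_spike_set negligible_subset[OF ae]) auto
    moreover have "integral {-l..<l} (\<lambda>x. g x * p' x) = integral {-l..<l} (\<lambda>x. G x * p' x)"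
      by (intro integral_cong) (simp add: Gg)
    moreover have "integral {-l..<l} (\<lambda>x. G x * p' x) = integral {-l..l} (\<lambda>x. G x * p' x)"
      by (intro integral_spike_set negligible_subset[OF ae]) auto
    ultimately show ?thesis by simp
  qed
  show thesis
  proof
    fix k :: nat
    have pc: "((\<lambda>x. cos (real k * pi * x / l)) has_real_derivative
        - (real k * pi / l) * sin (real k * pi * x / l)) (at x)" for x
      using l by (auto intro!: derivative_eq_intros)
    have ps: "((\<lambda>x. sin (real k * pi * x / l)) has_real_derivative
        (real k * pi / l) * cos (real k * pi * x / l)) (at x)" for x
      using l by (auto intro!: derivative_eq_intros)
    have kl: "real k * pi * l / l = real k * pi" "real k * pi * - l / l = - (real k * pi)"
      using l by auto
    have "integral {-l..<l} (\<lambda>x. h x * cos (real k * pi * x / l)) =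
        (-1) ^ k * (G l - G (-l)) - integral {-l..<l} (\<lambda>x. (- (real k * pi / l)) * (g x * sin (real k * pi * x / l)))"
      using parts[OF pc] l unfolding kl
      by (simp add: continuous_intros algebra_simps)
    also have "\<dots> = (-1) ^ k * (G l - G (-l))
        + real k * pi / l * integral {-l..<l} (\<lambda>x. g x * sin (real k * pi * x / l))"
      by (subst integral_mult_right) simp
    finally show "fourier_cos l h k
        = (-1) ^ k * ((G l - G (-l)) / l) + real k * pi / l * fourier_sin l g k"
      by (simp add: fourier_cos_def fourier_sin_def add_divide_distrib distrib_left)
    have "integral {-l..<l} (\<lambda>x. h x * sin (real k * pi * x / l)) =
        - integral {-l..<l} (\<lambda>x. (real k * pi / l) * (g x * cos (real k * pi * x / l)))"
      using parts[OF ps] l unfolding kl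
      by (simp add: continuous_intros algebra_simps)
    also have "\<dots> = - (real k * pi / l * integral {-l..<l} (\<lambda>x. g x * cos (real k * pi * x / l)))"
      by (subst integral_mult_right) simp
    finally show "fourier_sin l h k = - (real k * pi / l * fourier_cos l g k)"
      by (simp add: fourier_cos_def fourier_sin_def)
  qed
qed

text \<open>At \<open>x = -l\<close> all sines vanish and all cosines are \<open>1\<close> or \<open>-1\<close>, so the terms of the
  differentiated series are the coefficients below up to sign.\<close>

lemma differentiated_series_at_left_end:
  assumes l: "l > 0" and s: "summable (\<lambda>k. deriv (trig_term l a b k) (-l))"
  shows "(\<lambda>k. real k * pi / l * b k) \<longlonglongrightarrow> 0"
proof -
  have "\<bar>deriv (trig_term l a b k) (-l)\<bar> = \<bar>real k * pi / l * b k\<bar>" for k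
    using l by (simp add: deriv_trig_term trig_term_def abs_mult)
  then have "(\<lambda>k. \<bar>real k * pi / l * b k\<bar>) \<longlonglongrightarrow> 0"
    using tendsto_rabs[OF summable_LIMSEQ_zero[OF s]] by (simp only: abs_zero)
  then show ?thesis by (rule tendsto_rabs_zero_cancel)
qed

text \<open>At \<open>x = -l/2\<close> the cosines of odd index vanish and the sines of odd index are \<open>1\<close> or \<open>-1\<close>,
  so that convergence even makes \<open>k * a k\<close> tend to \<open>0\<close> along odd \<open>k\<close>.\<close>

lemma differentiated_series_at_quarter:
  assumes l: "l > 0" and s: "summable (\<lambda>k. deriv (trig_term l a b k) (-l/2))"
  shows "(\<lambda>k. a (2 * k + 1)) \<longlonglongrightarrow> 0"
proof -
  let ?u = "\<lambda>k. deriv (trig_term l a b k) (-l/2)"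
  have lim: "(\<lambda>k. \<bar>?u (2 * k + 1)\<bar>) \<longlonglongrightarrow> 0"
    using LIMSEQ_subseq_LIMSEQ[OF summable_LIMSEQ_zero[OF s], of "\<lambda>k. 2 * k + 1"]
    by (simp add: strict_mono_def o_def tendsto_rabs_zero_iff)
  have abs_u: "\<bar>?u (2 * k + 1)\<bar> = real (2 * k + 1) * pi / l * \<bar>a (2 * k + 1)\<bar>" for k
  proof -
    have arg: "real (2 * k + 1) * pi * (-l/2) / l = - (real k * pi + pi / 2)"
      using l by (simp add: field_simps)
    have c: "cos (real (2 * k + 1) * pi * (-l/2) / l) = 0"
      unfolding arg cos_minus cos_add by simp
    have "sin (real (2 * k + 1) * pi * (-l/2) / l) = - ((-1) ^ k)"
      unfolding arg sin_minus sin_add by simp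
    then have s: "\<bar>sin (real (2 * k + 1) * pi * (-l/2) / l)\<bar> = 1" by (simp add: abs_minus_cancel)
    have "?u (2 * k + 1) = - (real (2 * k + 1) * pi / l * a (2 * k + 1)) * sin (real (2 * k + 1) * pi * (-l/2) / l)"
      unfolding deriv_trig_term trig_term_def c by simp
    then show ?thesis using s l by (simp only: abs_mult abs_minus_cancel) (simp add: abs_mult)
  qed
  have "(\<lambda>k. l / pi * \<bar>?u (2 * k + 1)\<bar>) \<longlonglongrightarrow> l / pi * 0"
    by (intro tendsto_intros lim)
  then have lim': "(\<lambda>k. l / pi * \<bar>?u (2 * k + 1)\<bar>) \<longlonglongrightarrow> 0" by simp
  have le: "norm (a (2 * k + 1)) \<le> l / pi * \<bar>?u (2 * k + 1)\<bar>" for k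
  proof -
    have "l / pi * \<bar>?u (2 * k + 1)\<bar> = real (2 * k + 1) * \<bar>a (2 * k + 1)\<bar>"
      unfolding abs_u using l by simp
    moreover have "1 * \<bar>a (2 * k + 1)\<bar> \<le> real (2 * k + 1) * \<bar>a (2 * k + 1)\<bar>"
      by (intro mult_right_mono) auto
    ultimately show ?thesis by simp
  qed
  show ?thesis by (rule Lim_null_comparison[OF _ lim']) (use le in auto)
qed

text \<open>Since \<open>g\<close> may a priori jump between \<open>l\<close> and \<open>-l\<close>, the identity needs the two convergence
  hypotheses: along odd \<open>k\<close> the boundary term equals the constant \<open>-J\<close>, while both coefficients that
  it links tend to \<open>0\<close>.\<close>

lemma fourier_series_of_derivative:
  fixes g h :: "real \<Rightarrow> real"
  assumes l: "l > 0"
    and g: "\<And>x. x \<in> {-l..<l} \<Longrightarrow> (g has_real_derivative h x) (at x within {-l..<l})"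
    and h: "h integrable_on {-l..<l}"
    and sg: "summable (\<lambda>k. deriv (trig_term l (fourier_cos l g) (fourier_sin l g) k) (-l))"
    and sh: "summable (\<lambda>k. deriv (trig_term l (fourier_cos l h) (fourier_sin l h) k) (-l/2))"
  shows "trig_term l (fourier_cos l h) (fourier_sin l h) k
       = deriv (trig_term l (fourier_cos l g) (fourier_sin l g) k)"
proof -
  obtain J where
    J: "\<And>k. fourier_cos l h k = (-1) ^ k * J + real k * pi / l * fourier_sin l g k" and
    s: "\<And>k. fourier_sin l h k = - (real k * pi / l * fourier_cos l g k)"
    using fourier_coeffs_of_derivative[OF l g h] by metis
  have "(\<lambda>k. real (2 * k + 1) * pi / l * fourier_sin l g (2 * k + 1) - fourier_cos l h (2 * k + 1))
      \<longlonglongrightarrow> 0 - 0"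
    using LIMSEQ_subseq_LIMSEQ[OF differentiated_series_at_left_end[OF l sg], of "\<lambda>k. 2 * k + 1"]
    by (intro tendsto_diff differentiated_series_at_quarter[OF l sh])
       (simp add: strict_mono_def o_def)
  then have "(\<lambda>k::nat. J) \<longlonglongrightarrow> 0" by (simp add: J)
  then have "J = 0" by (simp add: LIMSEQ_const_iff)
  then show ?thesis
    unfolding deriv_trig_term by (simp add: J s trig_term_def fun_eq_iff)
qed

text \<open>The consequence of membership in \<open>FD\<close> that the differential equation uses: all derivatives
  of the sum are obtained term by term from the original series. The Fourier coefficients of \<open>D n\<close> are
  identified for \<open>n < N\<close>, where \<open>FD\<close> makes \<open>D n\<close> integrable; one more termwise derivative reaches \<open>N\<close>.\<close>

lemma trig_series_in_FD_derivatives: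
  assumes l: "l > 0" and N: "N > 0" and ab: "trig_series_in_FD l N a b"
  obtains D where
    "\<And>x. x \<in> {-l..<l} \<Longrightarrow> D 0 x = (\<Sum>k. trig_term l a b k x)"
    "\<And>n x. n < N \<Longrightarrow> x \<in> {-l..<l} \<Longrightarrow> (D n has_real_derivative D (Suc n) x) (at x within {-l..<l})"
    "\<And>n x. n \<le> N \<Longrightarrow> x \<in> {-l..<l} \<Longrightarrow> (\<lambda>k. (deriv ^^ n) (trig_term l a b k) x) sums D n x"
proof -
  define F where "F = (\<lambda>x. \<Sum>k. trig_term l a b k x)"
  have sumF: "(\<lambda>k. trig_term l a b k x) sums F x" if "x \<in> {-l..<l}" for x
    using ab that unfolding trig_series_in_FD_def F_def by (auto simp: summable_sums)
  have aF: "a k = fourier_cos l F k" for k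
    using ab unfolding trig_series_in_FD_def Let_def F_def by blast
  have bF: "b k = fourier_sin l F k" if "k \<ge> 1" for k
    using ab that unfolding trig_series_in_FD_def Let_def F_def by blast
  have N0: "N \<noteq> 0" using N by simp
  have "F \<in> FD l N"
    using ab unfolding trig_series_in_FD_def Let_def F_def by blast
  then obtain D where D0: "\<And>x. x \<in> {-l..<l} \<Longrightarrow> D 0 x = F x"
    and dD: "\<And>n x. n < N \<Longrightarrow> x \<in> {-l..<l} \<Longrightarrow> (D n has_real_derivative D (Suc n) x) (at x within {-l..<l})"
    and iD: "\<And>n. n < N \<Longrightarrow> D n absolutely_integrable_on {-l..<l}"
    and sD: "\<And>n x. n < N \<Longrightarrow> x \<in> {-l..<l} \<Longrightarrow>
          (\<lambda>k. deriv (trig_term l (fourier_cos l (D n)) (fourier_sin l (D n)) k) x) sums D (Suc n) x"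
    unfolding FD_def mem_Collect_eq if_not_P[OF N0] by blast
  have series: "trig_term l (fourier_cos l (D n)) (fourier_sin l (D n)) k
      = (deriv ^^ n) (trig_term l a b k)" if "n < N" for n k
    using that
  proof (induction n)
    case 0
    have "integral {-l..<l} (\<lambda>x. D 0 x * p x) = integral {-l..<l} (\<lambda>x. F x * p x)" for p
      by (intro integral_cong) (simp add: D0)
    then show ?case
      by (auto simp: trig_term_def fun_eq_iff aF bF fourier_cos_def fourier_sin_def)
  next
    case (Suc n)
    have "trig_term l (fourier_cos l (D (Suc n))) (fourier_sin l (D (Suc n))) k
       = deriv (trig_term l (fourier_cos l (D n)) (fourier_sin l (D n)) k)"
      using Suc.prems l
      by (intro fourier_series_of_derivative dD sums_summable[OF sD]
            set_lebesgue_integral_eq_integral(1)[OF iD]) auto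
    with Suc show ?case by simp
  qed
  show thesis
  proof
    show "(\<lambda>k. (deriv ^^ n) (trig_term l a b k) x) sums D n x"
      if n: "n \<le> N" and x: "x \<in> {-l..<l}" for n x
    proof (cases n)
      case 0
      then show ?thesis using sumF[OF x] D0[OF x] by simp
    next
      case (Suc n')
      then show ?thesis using sD[of n' x] series[of n'] n x by simp
    qed
  qed (use D0 dD F_def in auto)
qed

section \<open>Each term solves the equation\<close>

lemma sum_atMost_even_odd:
  fixes f :: "nat \<Rightarrow> 'a::comm_monoid_add"
  shows "(\<Sum>n=0..2*m. f n) = (\<Sum>n=0..m. f (2 * n)) + (\<Sum>n<m. f (2 * n + 1))"
proof (induction m)
  case (Suc m)
  have "2 * Suc m = Suc (Suc (2 * m))" by simp
  then have "(\<Sum>n=0..2 * Suc m. f n) = (\<Sum>n=0..2*m. f n) + f (2 * m + 1) + f (2 * Suc m)"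
    by (simp only: sum.atLeast0_atMost_Suc) simp
  also have "\<dots> = ((\<Sum>n=0..m. f (2 * n)) + f (2 * Suc m)) + ((\<Sum>n<m. f (2 * n + 1)) + f (2 * m + 1))"
    unfolding Suc.IH by (simp only: add.assoc add.commute add.left_commute)
  also have "\<dots> = (\<Sum>n=0..Suc m. f (2 * n)) + (\<Sum>n<Suc m. f (2 * n + 1))"
    by (simp only: sum.atLeast0_atMost_Suc sum.lessThan_Suc)
  finally show ?case .
qed simp

lemma spatial_operator_trig_term:
  "(\<Sum>n=0..2*m. A n i j * (deriv ^^ n) (trig_term l a b k) x) =
     freq_sigma m l A i j k * trig_term l a b k x
     + freq_omega m l A i j k * (b k * cos (real k * pi * x / l) - a k * sin (real k * pi * x / l))"
  unfolding sum_atMost_even_odd funpow_deriv_trig_term_even funpow_deriv_trig_term_odd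
    freq_sigma_def freq_omega_def sum_distrib_right
  by (intro arg_cong2[of _ _ _ _ "(+)"] sum.cong refl) (simp_all only: mult_ac)

lemma amp_has_real_derivative:
  "(cos_amp \<sigma> \<omega> c d has_real_derivative \<sigma> * cos_amp \<sigma> \<omega> c d t + \<omega> * sin_amp \<sigma> \<omega> c d t) (at t)"
  "(sin_amp \<sigma> \<omega> c d has_real_derivative \<sigma> * sin_amp \<sigma> \<omega> c d t - \<omega> * cos_amp \<sigma> \<omega> c d t) (at t)"
  unfolding cos_amp_def[abs_def] sin_amp_def[abs_def]
  by (auto intro!: derivative_eq_intros simp: algebra_simps)

text \<open>With \<open>0 ^ 0 = 1\<close>, the constant term of the series fits the general formula for the frequencies.\<close>

lemma freq_at_zero: "freq_sigma m l A i j 0 = A 0 i j" "freq_omega m l A i j 0 = 0"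
proof -
  have "(\<Sum>n=0..m. (-1) ^ n * A (2 * n) i j * (real 0 * pi / l) ^ (2 * n)) = (\<Sum>n\<in>{0..m}. if n = 0 then A 0 i j else 0)"
    by (intro sum.cong) auto
  then show "freq_sigma m l A i j 0 = A 0 i j" by (simp add: freq_sigma_def)
qed (simp add: freq_omega_def)

lemma psi_term_satisfies_equation:
  "((\<lambda>t. psi_term m l A \<tau> c d i j k t x) has_real_derivative
     (\<Sum>n=0..2*m. A n i j *
        (deriv ^^ n) (trig_term l (psi_cos m l A \<tau> c d i j t) (psi_sin m l A \<tau> c d i j t) k) x)) (at t)"
proof (cases "k = 0")
  case True
  then show ?thesis
    unfolding spatial_operator_trig_term
    by (auto intro!: derivative_eq_intros simp: psi_term_def trig_term_def psi_cos_def freq_at_zero)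
next
  case False
  define \<sigma> \<omega> p q where "\<sigma> = freq_sigma m l A i j k" and "\<omega> = freq_omega m l A i j k"
    and "p = coeff_c m l A \<tau> c d i j k" and "q = coeff_d m l A \<tau> c d i j k"
  have eq: "psi_term m l A \<tau> c d i j k t x =
    cos_amp \<sigma> \<omega> p q t * cos (real k * pi * x / l) + sin_amp \<sigma> \<omega> p q t * sin (real k * pi * x / l)" for t
    using False by (simp add: psi_term_def trig_term_def psi_cos_def psi_sin_def \<sigma>_def \<omega>_def p_def q_def)
  show ?thesis
    unfolding spatial_operator_trig_term eq
    using False
    by (auto intro!: derivative_eq_intros amp_has_real_derivative
        simp: trig_term_def psi_cos_def psi_sin_def algebra_simps
          simp flip: \<sigma>_def \<omega>_def p_def q_def)
qed

section \<open>Matching of consecutive series\<close>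

lemma psi_coeffs_initial:
  "psi_cos m l A \<tau> c d 0 j 0 k = c k" "psi_sin m l A \<tau> c d 0 j 0 k = d k"
  by (simp_all add: psi_cos_def psi_sin_def cos_amp_def sin_amp_def)

text \<open>The evolution rotates the pair of coefficients by the angle \<open>\<omega> * t\<close>, and the new coefficients
  in the recursion are the rotation of \<open>(p, q)\<close> by the opposite angle.\<close>

lemma amp_of_rotated_coeffs:
  assumes "p' = p * cos (\<omega> * t) - q * sin (\<omega> * t)" "q' = q * cos (\<omega> * t) + p * sin (\<omega> * t)"
  shows "cos_amp \<sigma> \<omega> p' q' t = exp (\<sigma> * t) * p" "sin_amp \<sigma> \<omega> p' q' t = exp (\<sigma> * t) * q"
proof -
  have sc: "sin (\<omega> * t) * sin (\<omega> * t) = 1 - cos (\<omega> * t) * cos (\<omega> * t)"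
    using sin_cos_squared_add[of "\<omega> * t"] by (simp add: power2_eq_square)
  have "p' * cos (\<omega> * t) + q' * sin (\<omega> * t)
      = p * (cos (\<omega> * t) * cos (\<omega> * t) + sin (\<omega> * t) * sin (\<omega> * t))"
    unfolding assms by (simp only: algebra_simps)
  then show "cos_amp \<sigma> \<omega> p' q' t = exp (\<sigma> * t) * p"
    by (simp add: cos_amp_def sc)
  have "q' * cos (\<omega> * t) - p' * sin (\<omega> * t)
      = q * (cos (\<omega> * t) * cos (\<omega> * t) + sin (\<omega> * t) * sin (\<omega> * t))"
    unfolding assms by (simp only: algebra_simps)
  then show "sin_amp \<sigma> \<omega> p' q' t = exp (\<sigma> * t) * q"
    by (simp add: sin_amp_def sc)
qed

lemma amp_exp_shift:
  "exp (\<sigma>' * t) * cos_amp (\<sigma> - \<sigma>') \<omega> p q t = cos_amp \<sigma> \<omega> p q t"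
  "exp (\<sigma>' * t) * sin_amp (\<sigma> - \<sigma>') \<omega> p q t = sin_amp \<sigma> \<omega> p q t"
proof -
  have "exp (\<sigma>' * t) * (exp ((\<sigma> - \<sigma>') * t) * r) = exp (\<sigma> * t) * r" for r
    by (simp add: mult.assoc[symmetric] exp_add[symmetric] algebra_simps)
  then show "exp (\<sigma>' * t) * cos_amp (\<sigma> - \<sigma>') \<omega> p q t = cos_amp \<sigma> \<omega> p q t"
    "exp (\<sigma>' * t) * sin_amp (\<sigma> - \<sigma>') \<omega> p q t = sin_amp \<sigma> \<omega> p q t"
    unfolding cos_amp_def sin_amp_def by blast+
qed

lemma psi_coeffs_match:
  "psi_cos m l A \<tau> c d (Suc i) j (\<tau> (Suc i)) k = psi_cos m l A \<tau> c d i j (\<tau> (Suc i)) k"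
  "k \<noteq> 0 \<Longrightarrow> psi_sin m l A \<tau> c d (Suc i) j (\<tau> (Suc i)) k = psi_sin m l A \<tau> c d i j (\<tau> (Suc i)) k"
proof -
  show "psi_cos m l A \<tau> c d (Suc i) j (\<tau> (Suc i)) k = psi_cos m l A \<tau> c d i j (\<tau> (Suc i)) k"
  proof (cases "k = 0")
    case True
    have "exp (t * r') * (exp (t * (r - r')) * z) = exp (t * r) * z" for t r r' z :: real
      by (simp add: mult.assoc[symmetric] exp_add[symmetric] algebra_simps)
    with True show ?thesis by (simp add: psi_cos_def)
  next
    case False
    then show ?thesis
      by (simp add: psi_cos_def Let_def amp_of_rotated_coeffs(1)[OF refl refl] amp_exp_shift)
  qed
  show "psi_sin m l A \<tau> c d (Suc i) j (\<tau> (Suc i)) k = psi_sin m l A \<tau> c d i j (\<tau> (Suc i)) k" if "k \<noteq> 0"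
    using that by (simp add: psi_sin_def Let_def amp_of_rotated_coeffs(2)[OF refl refl] amp_exp_shift)
qed

lemma psi_piece_match:
  "psi_piece m l A \<tau> c d (Suc i) j (\<tau> (Suc i)) x = psi_piece m l A \<tau> c d i j (\<tau> (Suc i)) x"
  unfolding psi_piece_def psi_term_def trig_term_def
  by (intro arg_cong[of _ _ suminf]) (auto simp: fun_eq_iff psi_coeffs_match)

section \<open>Piecewise functions on a grid\<close>

lemma partition_less:
  fixes \<tau> :: "nat \<Rightarrow> real"
  assumes "\<forall>i<I. \<tau> i < \<tau> (Suc i)" "i < j" "j \<le> I"
  shows "\<tau> i < \<tau> j"
  using assms(2,3)
proof (induction j)
  case (Suc j)
  then have "\<tau> j < \<tau> (Suc j)" using assms(1) by simp
  with Suc show ?case by (cases "i = j") simp_all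
qed simp

lemma partition_cell:
  fixes \<tau> :: "nat \<Rightarrow> real"
  assumes "\<tau> 0 \<le> t" "t < \<tau> I"
  obtains i where "i < I" "\<tau> i \<le> t" "t < \<tau> (Suc i)"
proof -
  have "\<exists>i<I. \<tau> i \<le> t \<and> t < \<tau> (Suc i)"
    using assms(2)
  proof (induction I)
    case 0
    then show ?case using assms(1) by simp
  next
    case (Suc I)
    then show ?case by (cases "t < \<tau> I") (auto simp: less_Suc_eq)
  qed
  then show thesis using that by blast
qed

lemma partition_cell_unique:
  fixes \<tau> :: "nat \<Rightarrow> real"
  assumes "\<forall>i<I. \<tau> i < \<tau> (Suc i)" "i < I" "j < I"
    and "t \<in> {\<tau> i..<\<tau> (Suc i)}" "t \<in> {\<tau> j..<\<tau> (Suc j)}"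
  shows "i = j"
proof -
  have "\<not> i < j" if "i < I" "j < I" "t \<in> {\<tau> i..<\<tau> (Suc i)}" "t \<in> {\<tau> j..<\<tau> (Suc j)}" for i j
  proof
    assume "i < j"
    then have "\<tau> (Suc i) \<le> \<tau> j"
      using partition_less[OF assms(1), of "Suc i" j] that by (cases "Suc i = j") auto
    with that show False by auto
  qed
  from this[of i j] this[of j i] assms(2-5) show ?thesis by (meson linorder_neqE_nat)
qed

lemma piecewise_on_cell:
  assumes \<tau>: "\<forall>i<I. \<tau> i < \<tau> (Suc i)" and \<xi>: "\<forall>j<J. \<xi> j < \<xi> (Suc j)"
    and i: "i < I" and j: "j < J"
    and t: "t \<in> {\<tau> i..<\<tau> (Suc i)}" and x: "x \<in> {\<xi> j..<\<xi> (Suc j)}"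
  shows "piecewise I J \<tau> \<xi> g t x = g i j t x"
proof -
  have cell: "(t, x) \<in> {\<tau> i'..<\<tau> (Suc i')} \<times> {\<xi> j'..<\<xi> (Suc j')} \<longleftrightarrow> i' = i \<and> j' = j"
    if "i' < I" "j' < J" for i' j'
    unfolding mem_Times_iff fst_conv snd_conv
    using partition_cell_unique[OF \<tau> that(1) i _ t] partition_cell_unique[OF \<xi> that(2) j _ x] t x
    by blast
  have "g i' j' t x * indicator ({\<tau> i'..<\<tau> (Suc i')} \<times> {\<xi> j'..<\<xi> (Suc j')}) (t, x)
      = (if i' = i then if j' = j then g i j t x else 0 else 0)" if "i' < I" "j' < J" for i' j'
    unfolding indicator_def cell[OF that] by simp
  then have "piecewise I J \<tau> \<xi> g t x
      = (\<Sum>i'<I. \<Sum>j'<J. if i' = i then if j' = j then g i j t x else 0 else 0)"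
    unfolding piecewise_def by (intro sum.cong refl) auto
  also have "\<dots> = (\<Sum>i'<I. if i' = i then g i j t x else 0)"
    using j by (intro sum.cong) auto
  finally show ?thesis using i by simp
qed

lemma continuous_on_glued:
  fixes \<tau> :: "nat \<Rightarrow> real" and f :: "real \<Rightarrow> real"
  assumes \<tau>0: "\<tau> 0 = 0" and \<tau>: "\<forall>i<I. \<tau> i < \<tau> (Suc i)"
    and f: "\<And>i t. i < I \<Longrightarrow> t \<in> {\<tau> i..<\<tau> (Suc i)} \<Longrightarrow> f t = g i t"
    and g: "\<And>i. i < I \<Longrightarrow> continuous_on {0..} (g i)"
    and match: "\<And>i. Suc i < I \<Longrightarrow> g (Suc i) (\<tau> (Suc i)) = g i (\<tau> (Suc i))"
  shows "continuous_on {0..<\<tau> I} f"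
proof -
  have pos: "0 \<le> \<tau> n" if "n \<le> I" for n
    using partition_less[OF \<tau>, of 0 n] that \<tau>0 by (cases "n = 0") auto
  \<comment> \<open>Closed pieces are glued, which needs \<open>f\<close> at the right end of each piece; the bound \<open>b < \<tau> I\<close>
      excludes the final time, where \<open>f\<close> is unrelated to the \<open>g i\<close>.\<close>
  have "continuous_on {0..b} f" if "n \<le> I" "b \<le> \<tau> n" "b < \<tau> I" for n b
    using that
  proof (induction n arbitrary: b)
    case 0
    then have "{0..b} \<subseteq> {0}" using \<tau>0 by auto
    then show ?case by (rule continuous_on_subset[rotated]) simp
  next
    case (Suc n)
    show ?case
    proof (cases "b \<le> \<tau> n")
      case True
      then show ?thesis using Suc by simp
    next
      case False
      have n: "n < I" using Suc.prems by simp
      have fg: "g n s = f s" if s: "s \<in> {\<tau> n..b}" for s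
      proof (cases "s < \<tau> (Suc n)")
        case True
        then show ?thesis using f[OF n, of s] s by simp
      next
        case False
        then have s': "s = \<tau> (Suc n)" using s Suc.prems by auto
        have "Suc n \<noteq> I" using s' s Suc.prems by auto
        then have "Suc n < I" using n by simp
        then show ?thesis using f[of "Suc n" s] match[of n] \<tau> s' by simp
      qed
      have "continuous_on {\<tau> n..b} (g n)"
        using pos[of n] n by (intro continuous_on_subset[OF g[OF n]]) auto
      then have "continuous_on {\<tau> n..b} f"
        by (rule continuous_on_eq) (rule fg)
      moreover have "continuous_on {0..\<tau> n} f"
        using Suc False by simp
      moreover have "{0..b} = {0..\<tau> n} \<union> {\<tau> n..b}"
        using False pos[of n] n by auto
      ultimately show ?thesis by (simp add: continuous_on_closed_Un)
    qed
  qed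
  then have cb: "continuous_on {0..b} f" if "b < \<tau> I" for b
    using that by (meson less_imp_le order_refl)
  show ?thesis
    unfolding continuous_on_eq_continuous_within
  proof
    fix t assume t: "t \<in> {0..<\<tau> I}"
    define b where "b = (t + \<tau> I) / 2"
    have b: "t < b" "b < \<tau> I" using t by (auto simp: b_def)
    have "continuous (at t within {0..b}) f"
      using cb[OF b(2)] t b by (simp add: continuous_on_eq_continuous_within)
    moreover have "at t within {0..b} = at t within {0..<\<tau> I}"
      by (rule at_within_nhd[of _ "{..<b}"]) (use b in auto)
    ultimately show "continuous (at t within {0..<\<tau> I}) f" by simp
  qed
qed

section \<open>Local derivatives and termwise differentiation in time\<close>

text \<open>Iterated two-sided derivatives depend only on the values near the point, so on an open set a chain
  of functions, each the derivative of the previous one, computes them.\<close>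

lemma funpow_deriv_eq_on_open:
  fixes D :: "nat \<Rightarrow> real \<Rightarrow> real"
  assumes S: "open S" and f: "\<And>y. y \<in> S \<Longrightarrow> f y = D 0 y"
    and D: "\<And>k y. k < N \<Longrightarrow> y \<in> S \<Longrightarrow> (D k has_real_derivative D (Suc k) y) (at y)"
  shows "n \<le> N \<Longrightarrow> y \<in> S \<Longrightarrow> (deriv ^^ n) f y = D n y"
    and "n < N \<Longrightarrow> y \<in> S \<Longrightarrow> ((deriv ^^ n) f has_real_derivative D (Suc n) y) (at y)"
proof -
  have step: "((deriv ^^ n) f has_real_derivative D (Suc n) y) (at y)"
    if "n < N" "y \<in> S" "\<And>y. y \<in> S \<Longrightarrow> (deriv ^^ n) f y = D n y" for n y
    by (rule has_field_derivative_transform_within_open[OF D S]) (use that in auto)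
  have eq: "n \<le> N \<Longrightarrow> y \<in> S \<Longrightarrow> (deriv ^^ n) f y = D n y" for n y
  proof (induction n arbitrary: y)
    case (Suc n)
    have "((deriv ^^ n) f has_real_derivative D (Suc n) y) (at y)"
      using Suc by (intro step) auto
    then show ?case by (simp add: DERIV_imp_deriv)
  qed (simp add: f)
  show "n \<le> N \<Longrightarrow> y \<in> S \<Longrightarrow> (deriv ^^ n) f y = D n y" by (rule eq)
  show "n < N \<Longrightarrow> y \<in> S \<Longrightarrow> ((deriv ^^ n) f has_real_derivative D (Suc n) y) (at y)"
    using step eq by simp
qed

text \<open>At an interior time the derivatives provided by termwise differentiability are the two-sided
  ones, hence unique, and the sum \<open>S\<close> may be computed from any known derivatives of the terms.\<close>

lemma termwise_differentiable_has_derivative: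
  assumes u: "termwise_differentiable u" and t: "t > 0"
    and u': "\<And>k. (u k has_real_derivative u' k) (at t)" and S: "u' sums S"
  shows "((\<lambda>s. \<Sum>k. u k s) has_real_derivative S) (at t)"
proof -
  have at: "at t within {0..} = at t"
    by (rule at_within_open_subset[of _ "{0<..}"]) (use t in auto)
  from u t obtain v S' where v: "\<And>k. (u k has_real_derivative v k) (at t)" and S': "v sums S'"
    and d: "((\<lambda>s. \<Sum>k. u k s) has_real_derivative S') (at t)"
    unfolding termwise_differentiable_def by (metis at less_imp_le)
  have "v = u'" using DERIV_unique[OF v u'] by (simp add: fun_eq_iff)
  with S S' have "S' = S" by (simp add: sums_unique2)
  with d show ?thesis by simp
qed

lemma termwise_differentiable_continuous:
  assumes "termwise_differentiable u"
  shows "continuous_on {0..} (\<lambda>s. \<Sum>k. u k s)"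
  unfolding continuous_on_eq_continuous_within
  using assms unfolding termwise_differentiable_def by (auto intro: DERIV_continuous)

section \<open>The glued series is a weak solution\<close>

theorem theorem3p2:
  fixes m I J :: nat and l T :: real
    and \<tau> \<xi> :: "nat \<Rightarrow> real"
    and A :: "nat \<Rightarrow> nat \<Rightarrow> nat \<Rightarrow> real"
    and c d :: "nat \<Rightarrow> real"
  assumes "m \<ge> 1" and "l > 0" and "T > 0"
    and "\<tau> 0 = 0" and "\<tau> I = T" and "\<forall>i<I. \<tau> i < \<tau> (Suc i)"
    and "\<xi> 0 = -l" and "\<xi> J = l" and "\<forall>j<J. \<xi> j < \<xi> (Suc j)"
    and "trig_series_in_FD l 0 c d"
    and "\<forall>i<I. \<forall>j<J. \<forall>t\<ge>0.
           trig_series_in_FD l (2 * m) (psi_cos m l A \<tau> c d i j t) (psi_sin m l A \<tau> c d i j t)"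
    and "\<forall>i<I. \<forall>j<J. \<forall>x\<in>{-l..<l}.
           termwise_differentiable (\<lambda>k t. psi_term m l A \<tau> c d i j k t x)"
  shows "weak_solution m l T I J \<tau> \<xi>
           (\<lambda>n. piecewise I J \<tau> \<xi> (\<lambda>i j t x. A n i j)) c d
           (piecewise I J \<tau> \<xi> (psi_piece m l A \<tau> c d))"
proof -
  note \<tau> = assms(6) and \<xi> = assms(9)
  let ?psi = "psi_piece m l A \<tau> c d"
  let ?\<Psi> = "piecewise I J \<tau> \<xi> ?psi"
  let ?term = "\<lambda>i j t. trig_term l (psi_cos m l A \<tau> c d i j t) (psi_sin m l A \<tau> c d i j t)"
  have \<tau>_nonneg: "0 \<le> \<tau> i" if "i \<le> I" for i
    using partition_less[OF \<tau>, of 0 i] that assms(4) by (cases "i = 0") auto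
  have \<xi>_bounds: "-l \<le> \<xi> j \<and> \<xi> (Suc j) \<le> l" if "j < J" for j
    using partition_less[OF \<xi>, of 0 j] partition_less[OF \<xi>, of "Suc j" J] that assms(7,8)
    by (cases "j = 0"; cases "Suc j = J") auto
  have cell_t: "\<exists>i<I. t \<in> {\<tau> i..<\<tau> (Suc i)}" if "t \<in> {0..<T}" for t
    using partition_cell[of \<tau> t I] that assms(4,5) by auto
  have cell_x: "\<exists>j<J. x \<in> {\<xi> j..<\<xi> (Suc j)}" if "x \<in> {-l..<l}" for x
    using partition_cell[of \<xi> x J] that assms(7,8) by auto
  note on_cell = piecewise_on_cell[OF \<tau> \<xi>]
  \<comment> \<open>The open \<open>x\<close>-cell lies in the interior of the domain, so the derivatives within the half-open
      interval become two-sided there.\<close>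
  have spatial: "\<exists>D. (\<forall>y\<in>{\<xi> j<..<\<xi> (Suc j)}. ?\<Psi> t y = D 0 y) \<and>
      (\<forall>n<2*m. \<forall>y\<in>{\<xi> j<..<\<xi> (Suc j)}. (D n has_real_derivative D (Suc n) y) (at y)) \<and>
      (\<forall>n\<le>2*m. \<forall>y\<in>{\<xi> j<..<\<xi> (Suc j)}. (\<lambda>k. (deriv ^^ n) (?term i j t k) y) sums D n y)"
    if i: "i < I" and j: "j < J" and t: "t \<in> {\<tau> i..<\<tau> (Suc i)}" for i j t
  proof -
    have "t \<ge> 0" using t \<tau>_nonneg[of i] i by auto
    then have series:
      "trig_series_in_FD l (2 * m) (psi_cos m l A \<tau> c d i j t) (psi_sin m l A \<tau> c d i j t)"
      using assms(11) i j by blast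
    have "0 < 2 * m" using assms(1) by simp
    from trig_series_in_FD_derivatives[OF assms(2) this series] obtain D where
      D0: "\<And>x. x \<in> {-l..<l} \<Longrightarrow> D 0 x = (\<Sum>k. ?term i j t k x)" and
      dD: "\<And>n x. n < 2*m \<Longrightarrow> x \<in> {-l..<l} \<Longrightarrow> (D n has_real_derivative D (Suc n) x) (at x within {-l..<l})" and
      sD: "\<And>n x. n \<le> 2*m \<Longrightarrow> x \<in> {-l..<l} \<Longrightarrow> (\<lambda>k. (deriv ^^ n) (?term i j t k) x) sums D n x"
      by blast
    have sub: "{\<xi> j<..<\<xi> (Suc j)} \<subseteq> {-l..<l}" using \<xi>_bounds[OF j] by auto
    have "?\<Psi> t y = D 0 y" if y: "y \<in> {\<xi> j<..<\<xi> (Suc j)}" for y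
      using on_cell[OF i j t, of y ?psi] D0[of y] y sub by (auto simp: psi_piece_def psi_term_def)
    moreover have "(D n has_real_derivative D (Suc n) y) (at y)"
      if "n < 2*m" and y: "y \<in> {\<xi> j<..<\<xi> (Suc j)}" for n y
      using dD[OF that(1), of y] y sub at_within_open_subset[OF y _ sub] by auto
    ultimately show ?thesis using sD sub by (intro exI[of _ D]) blast
  qed
  show ?thesis
    unfolding weak_solution_def
  proof (intro conjI ballI impI)
    fix t x assume t: "t \<in> {0..<T}" and x: "x \<in> {-l..<l}"
      and tn: "\<forall>i\<le>I. t \<noteq> \<tau> i" and xn: "\<forall>j\<le>J. x \<noteq> \<xi> j"
    obtain i where i: "i < I" and ti: "t \<in> {\<tau> i..<\<tau> (Suc i)}" using cell_t[OF t] by blast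
    obtain j where j: "j < J" and xj: "x \<in> {\<xi> j..<\<xi> (Suc j)}" using cell_x[OF x] by blast
    have ti': "t \<in> {\<tau> i<..<\<tau> (Suc i)}" using ti tn i by (auto simp: less_le)
    have xj': "x \<in> {\<xi> j<..<\<xi> (Suc j)}" using xj xn j by (auto simp: less_le)
    have t0: "t > 0" using ti' \<tau>_nonneg[of i] i by auto
    obtain D where D: "\<And>y. y \<in> {\<xi> j<..<\<xi> (Suc j)} \<Longrightarrow> ?\<Psi> t y = D 0 y"
      "\<And>n y. n < 2*m \<Longrightarrow> y \<in> {\<xi> j<..<\<xi> (Suc j)} \<Longrightarrow> (D n has_real_derivative D (Suc n) y) (at y)"
      "\<And>n y. n \<le> 2*m \<Longrightarrow> y \<in> {\<xi> j<..<\<xi> (Suc j)} \<Longrightarrow> (\<lambda>k. (deriv ^^ n) (?term i j t k) y) sums D n y"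
      using spatial[OF i j ti] by blast
    have deriv_eq: "(deriv ^^ n) (?\<Psi> t) x = D n x" if "n \<le> 2 * m" for n
      by (rule funpow_deriv_eq_on_open(1)[OF open_greaterThanLessThan D(1,2) that xj'])
    have "(\<lambda>k. \<Sum>n=0..2*m. A n i j * (deriv ^^ n) (?term i j t k) x) sums (\<Sum>n=0..2*m. A n i j * D n x)"
      using xj' by (intro sums_sum sums_mult D(3)) auto
    then have "((\<lambda>s. \<Sum>k. psi_term m l A \<tau> c d i j k s x) has_real_derivative
        (\<Sum>n=0..2*m. A n i j * D n x)) (at t)"
      using assms(12) i j x t0
      by (intro termwise_differentiable_has_derivative[OF _ _ psi_term_satisfies_equation]) auto
    then have dt: "((\<lambda>s. ?\<Psi> s x) has_real_derivative (\<Sum>n=0..2*m. A n i j * D n x)) (at t)"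
      by (rule has_field_derivative_transform_within_open[of _ _ _ "{\<tau> i<..<\<tau> (Suc i)}"])
         (use ti' on_cell[OF i j _ xj, of _ ?psi] in \<open>auto simp: psi_piece_def\<close>)
    show "(\<lambda>s. ?\<Psi> s x) differentiable (at t)"
      using dt real_differentiable_def by blast
    have diff: "((deriv ^^ n) (?\<Psi> t)) differentiable (at y)"
      if "n < 2 * m" "y \<in> {\<xi> j<..<\<xi> (Suc j)}" for n y
    proof -
      have "((deriv ^^ n) (?\<Psi> t) has_real_derivative D (Suc n) y) (at y)"
        by (rule funpow_deriv_eq_on_open(2)[OF open_greaterThanLessThan D(1,2) that])
      then show ?thesis using real_differentiable_def by blast
    qed
    have near: "\<forall>\<^sub>F y in nhds x. y \<in> {\<xi> j<..<\<xi> (Suc j)}"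
      using xj' by (intro eventually_nhds_in_open) auto
    show "times_differentiable_at (2 * m) (?\<Psi> t) x"
      unfolding times_differentiable_at_def
      using diff xj' by (auto intro!: eventually_mono[OF near])
    have "deriv (\<lambda>s. ?\<Psi> s x) t = (\<Sum>n=0..2*m. A n i j * D n x)"
      using dt by (rule DERIV_imp_deriv)
    also have "\<dots> = (\<Sum>n=0..2*m. piecewise I J \<tau> \<xi> (\<lambda>i j t x. A n i j) t x * (deriv ^^ n) (?\<Psi> t) x)"
      using on_cell[OF i j ti xj] deriv_eq by (intro sum.cong) auto
    finally show "deriv (\<lambda>s. ?\<Psi> s x) t =
      (\<Sum>n=0..2*m. piecewise I J \<tau> \<xi> (\<lambda>i j t x. A n i j) t x * (deriv ^^ n) (?\<Psi> t) x)" .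
  next
    fix x assume x: "x \<in> {-l..<l}"
    have "\<tau> I > \<tau> 0" using assms(3-5) by simp
    then have "I > 0" by (cases I) auto
    obtain j where j: "j < J" and xj: "x \<in> {\<xi> j..<\<xi> (Suc j)}" using cell_x[OF x] by blast
    have "?\<Psi> 0 x = (\<Sum>k. trig_term l c d k x)"
      using on_cell[OF \<open>I > 0\<close> j _ xj, of 0 ?psi] \<tau>[rule_format, OF \<open>I > 0\<close>] assms(4)
      by (simp add: psi_piece_def psi_term_def trig_term_def psi_coeffs_initial cong: if_cong)
    then show "(\<lambda>k. trig_term l c d k x) sums ?\<Psi> 0 x"
      using assms(10) x unfolding trig_series_in_FD_def by (auto simp: summable_sums)
    show "continuous_on {0..<T} (\<lambda>t. ?\<Psi> t x)"
      unfolding assms(5)[symmetric]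
    proof (rule continuous_on_glued[OF assms(4) \<tau>])
      show "?\<Psi> t x = ?psi i j t x" if "i < I" "t \<in> {\<tau> i..<\<tau> (Suc i)}" for i t
        using on_cell[OF that(1) j that(2) xj] .
      show "continuous_on {0..} (\<lambda>t. ?psi i j t x)" if "i < I" for i
        unfolding psi_piece_def using assms(12) that j x
        by (intro termwise_differentiable_continuous) blast
    qed (rule psi_piece_match)
  next
    fix t x assume t: "t \<in> {0..<T}" and x: "x \<in> {-l..<l} - \<xi> ` {..<J}"
    obtain i where i: "i < I" and ti: "t \<in> {\<tau> i..<\<tau> (Suc i)}" using cell_t[OF t] by blast
    obtain j where j: "j < J" and xj: "x \<in> {\<xi> j..<\<xi> (Suc j)}" using cell_x x by blast
    have xj': "x \<in> {\<xi> j<..<\<xi> (Suc j)}" using xj x j by (auto simp: less_le)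
    obtain D where D: "\<And>y. y \<in> {\<xi> j<..<\<xi> (Suc j)} \<Longrightarrow> ?\<Psi> t y = D 0 y"
      "\<And>n y. n < 2*m \<Longrightarrow> y \<in> {\<xi> j<..<\<xi> (Suc j)} \<Longrightarrow> (D n has_real_derivative D (Suc n) y) (at y)"
      using spatial[OF i j ti] by blast
    have "(?\<Psi> t has_real_derivative D 1 x) (at x)"
      by (rule has_field_derivative_transform_within_open[of "D 0" _ _ "{\<xi> j<..<\<xi> (Suc j)}"])
         (use D(2)[of 0 x] D(1) assms(1) xj' in auto)
    then show "continuous (at x within {-l..<l}) (?\<Psi> t)"
      using DERIV_isCont continuous_at_imp_continuous_at_within by blast
  qed
qed

end
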